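(* Let $k\ge 1$ and let $f:\mathbb{D}\to\mathbb{D}$ be holomorphic and not a Blaschke product of degree at most $k$. Let $\sigma\in\partial\mathbb{D}$ be such that $\beta_f(\sigma)<+\infty$. Then $$\frac{|\Delta_{w_k,\ldots,w_1}f(\sigma)-\Delta_{w_k,\ldots,w_1}f(z)|^2}{1-|\Delta_{w_k,\ldots,w_1}f(z)|^2}\le\beta_{\Delta_{w_k,\ldots,w_1}f}(\sigma)\,\frac{|\sigma-z|^2}{1-|z|^2}$$ for all $z,w_1,\ldots,w_k\in\mathbb{D}$. Moreover, equality occurs for some $z_0,w_1,\ldots,w_k\in\mathbb{D}$ (with $z=z_0$) if and only if it occurs for all $z,w_1,\ldots,w_k\in\mathbb{D}$, if and only if $f$ is a Blaschke product of degree $k+1$.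
   Context: $\mathbb{D}=\{z\in\mathbb{C}:|z|<1\}$ and $\partial\mathbb{D}$ is the unit circle. For a holomorphic $g:\mathbb{D}\to\mathbb{D}$ and $\sigma\in\partial\mathbb{D}$, the boundary dilation coefficient is $\beta_g(\sigma)=\liminf_{z\to\sigma}\frac{1-|g(z)|}{1-|z|}$. A Blaschke product of degree $d\ge 1$ is a function $B(z)=e^{i\theta}\prod_{j=1}^d\frac{z-a_j}{1-\overline{a_j}z}$ with $\theta\in\mathbb{R}$, $a_1,\ldots,a_d\in\mathbb{D}$; those of degree $0$ are the constants of modulus $1$. For $g:\mathbb{D}\to\mathbb{D}$ holomorphic and $w\in\mathbb{D}$, the hyperbolic difference quotient is the holomorphic function $\Delta_w g(z)=g^*(z,w)$, where $g^*(z,w)=\frac{g(z)-g(w)}{1-\overline{g(w)}g(z)}\big/\frac{z-w}{1-\overline{w}z}$ for $z\ne w$ and $g^*(w,w)=g'(w)\frac{1-|w|^2}{1-|g(w)|^2}$. Inductively, $\Delta_{w_k,\ldots,w_1}f=\Delta_{w_k}(\Delta_{w_{k-1},\ldots,w_1}f)$. If $f$ is not a Blaschke product of degree at most $k$, then $\Delta_{w_k,\ldots,w_1}f$ is a well-defined holomorphic map $\mathbb{D}\to\mathbb{D}$. If $\beta_f(\sigma)<+\infty$, then $\Delta_{w_k,\ldots,w_1}f$ has a non-tangential limit at $\sigma$ (limit as $z\to\sigma$ inside each region $\{z\in\mathbb{D}:|\sigma-z|<M(1-|z|)\}$, $M>1$), lying in $\partial\mathbb{D}$ and denoted $\Delta_{w_k,\ldots,w_1}f(\sigma)$.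 *)

theory Defs
  imports "HOL-Complex_Analysis.Complex_Analysis"
begin

text \<open>Functions on the unit disc are total functions \<open>complex \<Rightarrow> complex\<close>; every notion below depends
  only on their values on \<open>ball 0 1\<close>.\<close>

abbreviation unit_disc :: "complex set" ("\<bbbD>")
  where "\<bbbD> \<equiv> ball 0 1"

definition blaschke_product :: "nat \<Rightarrow> (complex \<Rightarrow> complex) \<Rightarrow> bool" where
  "blaschke_product d B \<longleftrightarrow>
     (\<exists>(\<theta>::real) (a :: nat \<Rightarrow> complex). (\<forall>j\<in>{1..d}. a j \<in> \<bbbD>) \<and>
        (\<forall>z\<in>\<bbbD>. B z = exp (\<i> * complex_of_real \<theta>) * (\<Prod>j=1..d. (z - a j) / (1 - cnj (a j) * z))))"

definition boundary_dilation :: "(complex \<Rightarrow> complex) \<Rightarrow> complex \<Rightarrow> ereal" where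
  "boundary_dilation g \<sigma> =
     Liminf (at \<sigma> within \<bbbD>) (\<lambda>z. ereal ((1 - norm (g z)) / (1 - norm z)))"

definition hyp_diff_quot :: "complex \<Rightarrow> (complex \<Rightarrow> complex) \<Rightarrow> complex \<Rightarrow> complex" where
  "hyp_diff_quot w g z =
     (if z = w
      then deriv g w * complex_of_real ((1 - (norm w)\<^sup>2) / (1 - (norm (g w))\<^sup>2))
      else ((g z - g w) / (1 - cnj (g w) * g z)) / ((z - w) / (1 - cnj w * z)))"

text \<open>\<open>iter_hyp_diff_quot w k f\<close> is \<open>\<Delta>\<close> of \<open>f\<close> with respect to \<open>w k, \<dots>, w 1\<close>, where the point \<open>w 1\<close> is
  used first; \<open>w 0\<close> is not used.\<close>

primrec iter_hyp_diff_quot :: "(nat \<Rightarrow> complex) \<Rightarrow> nat \<Rightarrow> (complex \<Rightarrow> complex) \<Rightarrow> complex \<Rightarrow> complex" where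
  "iter_hyp_diff_quot w 0 f = f"
| "iter_hyp_diff_quot w (Suc k) f = hyp_diff_quot (w (Suc k)) (iter_hyp_diff_quot w k f)"

definition stolz_region :: "complex \<Rightarrow> real \<Rightarrow> complex set" where
  "stolz_region \<sigma> M = {z \<in> \<bbbD>. norm (\<sigma> - z) < M * (1 - norm z)}"

definition has_nontangential_limit :: "(complex \<Rightarrow> complex) \<Rightarrow> complex \<Rightarrow> complex \<Rightarrow> bool" where
  "has_nontangential_limit g \<sigma> l \<longleftrightarrow> (\<forall>M>1. (g \<longlongrightarrow> l) (at \<sigma> within stolz_region \<sigma> M))"

text \<open>The limit is unique when \<open>\<sigma>\<close> is on the unit circle, since for \<open>M > 1\<close> every region contains the
  radius ending at \<open>\<sigma>\<close>.\<close>

definition nontangential_limit :: "(complex \<Rightarrow> complex) \<Rightarrow> complex \<Rightarrow> complex" where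
  "nontangential_limit g \<sigma> = (THE l. has_nontangential_limit g \<sigma> l)"

end

theory Submission
  imports Defs "HOL-Computational_Algebra.Fundamental_Theorem_Algebra"
begin

text \<open>The statement has two independent halves, an algebraic one and an analytic one.

  Algebra: moving \<open>f w\<close> to \<open>0\<close> by an automorphism and dividing by the Blaschke factor with zero \<open>w\<close> lowers the
  Blaschke degree by exactly one (\<open>blaschke_product_hyp_diff_quot_iff\<close>). The division accounts for the
  drop, since composing a Blaschke product of degree \<open>d\<close> from the left with an automorphism of the disc
  gives a Blaschke product of degree \<open>d\<close> again
  (\<open>blaschke_product_disc_aut_comp\<close>), which is the fundamental theorem of algebra plus a reflection
  argument. The Schwarz-Pick lemma bounds the quotient by \<open>1\<close>, and by the maximum principle it can reach
  \<open>1\<close> only if \<open>f\<close> has degree \<open>1\<close>. Hence, as long as \<open>f\<close> is not a Blaschke product of degree at most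
  \<open>k\<close>, the \<open>k\<close>-fold quotient \<open>g\<close> is a holomorphic self-map of the disc, and it is an automorphism, that is a
  Blaschke product of degree \<open>1\<close>, iff \<open>f\<close> is a Blaschke product of degree \<open>k + 1\<close>
  (\<open>iter_hyp_diff_quot_properties\<close>).

  Analysis: for a single holomorphic self-map \<open>g\<close> of the disc, the inequality is Julia's lemma, and equality
  at one point forces \<open>g\<close> to be an automorphism, for which equality holds everywhere (\<open>Julia_lemma\<close>). If the
  dilation of \<open>g\<close> is infinite, the inequality is strict for the trivial reason that its right-hand side is
  infinite, in accordance with automorphisms having finite dilation. If the dilation is finite, the
  inequality is the limit of the Schwarz-Pick inequality along a sequence that attains the lower limit; it
  also shows that the non-tangential limit exists. After a Cayley transform of \<open>g\<close> it compares two positive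
  harmonic functions, and the case of equality is the maximum principle for their difference.\<close>

section \<open>Automorphisms of the disc and the Schwarz-Pick lemma\<close>

abbreviation disc_aut :: "complex \<Rightarrow> complex \<Rightarrow> complex"
  where "disc_aut a z \<equiv> (z - a) / (1 - cnj a * z)"

lemma norm_diff_conj_identity:
  "(norm (1 - cnj a * z))\<^sup>2 - (norm (z - a))\<^sup>2 = (1 - (norm a)\<^sup>2) * (1 - (norm z)\<^sup>2)"
  unfolding cmod_power2 by (simp add: algebra_simps power2_eq_square)

lemma one_minus_cnj_mult_nonzero:
  assumes "norm a < 1" "norm z \<le> 1"
  shows "1 - cnj a * z \<noteq> 0"
proof
  assume "1 - cnj a * z = 0"
  then have "norm a * norm z = 1"
    by (metis complex_mod_cnj eq_iff_diff_eq_0 norm_mult norm_one)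
  with assms show False
    by (metis mult_left_le norm_ge_zero not_less)
qed

lemma one_minus_norm_disc_aut:
  assumes "norm a < 1" "norm z \<le> 1"
  shows "1 - (norm (disc_aut a z))\<^sup>2 = (1 - (norm a)\<^sup>2) * (1 - (norm z)\<^sup>2) / (norm (1 - cnj a * z))\<^sup>2"
  using one_minus_cnj_mult_nonzero[OF assms] norm_diff_conj_identity[of a z]
  by (simp add: norm_divide power_divide field_simps)

lemma one_minus_norm_square_pos: "norm z < 1 \<Longrightarrow> 0 < 1 - (norm z)\<^sup>2"
  by (simp add: power_less_one_iff)

lemma norm_disc_aut_less_1:
  assumes "norm a < 1" "norm z < 1"
  shows "norm (disc_aut a z) < 1"
  using Moebius_function_norm_lt_1[OF assms, of 0] by (simp add: Moebius_function_simple)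

lemma disc_aut_inverse:
  assumes "norm a < 1" "norm z < 1"
  shows "disc_aut (- a) (disc_aut a z) = z"
  using Moebius_function_compose[of "-a" a z] assms by (simp add: Moebius_function_simple)

lemma holomorphic_disc_aut:
  assumes "norm a < 1" shows "disc_aut a holomorphic_on \<bbbD>"
  using one_minus_cnj_mult_nonzero[OF assms] by (intro holomorphic_intros) auto

lemma holomorphic_disc_aut_comp:
  assumes "norm a < 1" "f holomorphic_on \<bbbD>" "f ` \<bbbD> \<subseteq> \<bbbD>"
  shows "(\<lambda>z. disc_aut a (f z)) holomorphic_on \<bbbD>"
  using holomorphic_on_compose_gen[OF assms(2) holomorphic_disc_aut[OF assms(1)] assms(3)]
  by (simp add: o_def)

text \<open>Conjugating with automorphisms that move \<open>w\<close> and \<open>f w\<close> to \<open>0\<close> reduces this to the Schwarz lemma.\<close>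
lemma Schwarz_Pick:
  assumes f: "f holomorphic_on \<bbbD>" "f ` \<bbbD> \<subseteq> \<bbbD>" and w: "w \<in> \<bbbD>" and z: "z \<in> \<bbbD>"
  shows "norm (disc_aut (f w) (f z)) \<le> norm (disc_aut w z)"
proof -
  define G where "G u = disc_aut (f w) (f (disc_aut (- w) u))" for u
  have fD: "norm (f x) < 1" if "norm x < 1" for x
    using f(2) that by force
  have wD: "norm w < 1" "norm (- w) < 1" and zD: "norm z < 1" using w z by auto
  have "(\<lambda>u. f (disc_aut (- w) u)) holomorphic_on \<bbbD>"
    using holomorphic_on_compose_gen[OF holomorphic_disc_aut[OF wD(2)] f(1)]
      norm_disc_aut_less_1[OF wD(2)] by (force simp: o_def)
  moreover have "(\<lambda>u. f (disc_aut (- w) u)) ` \<bbbD> \<subseteq> \<bbbD>"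
    using norm_disc_aut_less_1[OF wD(2)] fD by (force)
  ultimately have "G holomorphic_on \<bbbD>"
    unfolding G_def by (rule holomorphic_disc_aut_comp[OF fD[OF wD(1)]])
  moreover have "G 0 = 0" by (simp add: G_def)
  moreover have "norm (G u) < 1" if "norm u < 1" for u
    unfolding G_def using norm_disc_aut_less_1 fD wD that by presburger
  ultimately have "norm (G (disc_aut w z)) \<le> norm (disc_aut w z)"
    using Schwarz_Lemma(1)[of G "disc_aut w z"] norm_disc_aut_less_1[OF wD(1) zD] by blast
  then show ?thesis
    unfolding G_def by (simp only: disc_aut_inverse[OF wD(1) zD])
qed

section \<open>Blaschke products under composition with automorphisms\<close>

text \<open>A unimodular factor is easier to multiply and divide than an explicit argument \<open>\<theta>\<close>.\<close>
lemma blaschke_product_altdef: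
  "blaschke_product d B \<longleftrightarrow>
     (\<exists>c a. norm c = 1 \<and> (\<forall>j\<in>{1..d}. a j \<in> \<bbbD>) \<and> (\<forall>z\<in>\<bbbD>. B z = c * (\<Prod>j=1..d. disc_aut (a j) z)))"
  (is "_ \<longleftrightarrow> ?R")
proof
  assume "blaschke_product d B"
  then show ?R
    unfolding blaschke_product_def using norm_exp_i_times by blast
next
  assume ?R
  then obtain c a where "norm c = 1" "\<forall>j\<in>{1..d}. a j \<in> \<bbbD>"
    "\<forall>z\<in>\<bbbD>. B z = c * (\<Prod>j=1..d. disc_aut (a j) z)" by blast
  moreover from \<open>norm c = 1\<close> obtain t where "c = exp (\<i> * complex_of_real t)"
    by (metis complex_norm_eq_1_exp)
  ultimately show "blaschke_product d B"
    unfolding blaschke_product_def by blast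
qed

text \<open>The factors \<open>1 - cnj (a j) * z\<close> of a Blaschke denominator are constant when \<open>a j = 0\<close>, so the degree of
  their product is only bounded; the coefficient at the expected degree is still the product of the
  coefficients of \<open>z\<close>.\<close>
lemma coeff_prod_linear:
  assumes "finite A"
  shows "degree (\<Prod>j\<in>A. [:u j, v j:]) \<le> card A \<and>
         coeff (\<Prod>j\<in>A. [:u j, v j:]) (card A) = (\<Prod>j\<in>A. v j :: complex)"
  using assms
proof (induction A rule: finite_induct)
  case empty
  then show ?case by simp
next
  case (insert x A)
  let ?P = "\<Prod>j\<in>A. [:u j, v j:]"
  have "degree ([:u x, v x:] * ?P) \<le> Suc (card A)"
    using degree_mult_le[of "[:u x, v x:]" ?P] insert.IH degree_pCons_le[of "u x" "[:v x:]"]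
    by simp
  moreover have "coeff ?P (Suc (card A)) = 0"
    using insert.IH by (intro coeff_eq_0) auto
  ultimately show ?case
    using insert by (simp add: coeff_pCons)
qed

text \<open>Write \<open>B = c * p / q\<close> with \<open>p = (\<Prod>j. z - a j)\<close> and \<open>q\<close> its reflection, \<open>q(z) = z^d * cnj (p (1 / cnj z))\<close>. Then
  the composition is \<open>(c * p - b * q) / (q - cnj b * c * p)\<close>. The numerator has degree exactly \<open>d\<close>, and all
  of its roots lie in the disc since \<open>norm q \<le> norm p\<close> outside of it; reflecting the factored numerator
  gives the denominator up to a unimodular constant.\<close>
lemma blaschke_product_disc_aut_comp:
  assumes B: "blaschke_product d B" and b: "b \<in> \<bbbD>"
  shows "blaschke_product d (\<lambda>z. disc_aut b (B z))"
proof -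
  obtain c a where c: "norm c = 1" and aD: "\<forall>j\<in>{1..d}. a j \<in> \<bbbD>"
    and BD: "\<forall>z\<in>\<bbbD>. B z = c * (\<Prod>j=1..d. disc_aut (a j) z)"
    using B unfolding blaschke_product_altdef by blast
  have a: "norm (a j) < 1" if "j \<in> {1..d}" for j
    using aD that by simp
  define p where "p = (\<Prod>j=1..d. [:- a j, 1:])"
  define q where "q = (\<Prod>j=1..d. [:1, - cnj (a j):])"
  define N where "N = smult c p - smult b q"
  \<comment> \<open>The coefficient of \<open>z ^ d\<close> in \<open>N\<close>; it is nonzero because \<open>norm c = 1\<close>, \<open>norm b < 1\<close>
    and the product has norm at most \<open>1\<close>.\<close>
  define \<kappa> where "\<kappa> = c - b * (\<Prod>j=1..d. - cnj (a j))"
  have b1: "norm b < 1" using b by simp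
  have p: "degree p \<le> d" "coeff p d = 1" and q: "degree q \<le> d" "coeff q d = (\<Prod>j=1..d. - cnj (a j))"
    using coeff_prod_linear[of "{1..d}" "\<lambda>j. - a j" "\<lambda>j. 1"]
      coeff_prod_linear[of "{1..d}" "\<lambda>j. 1" "\<lambda>j. - cnj (a j)"] by (auto simp: p_def q_def)
  have pz: "poly p z = (\<Prod>j=1..d. z - a j)" and qz: "poly q z = (\<Prod>j=1..d. 1 - cnj (a j) * z)" for z
    by (simp_all add: p_def q_def poly_prod algebra_simps)
  have "norm (\<Prod>j=1..d. - cnj (a j)) \<le> 1"
    unfolding prod_norm[symmetric] using a by (intro prod_le_1) (auto simp: less_imp_le)
  then have "norm (b * (\<Prod>j=1..d. - cnj (a j))) < 1"
    unfolding norm_mult[of b] using b1 mult_left_le[of "norm (\<Prod>j=1..d. - cnj (a j))" "norm b"] by simp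
  then have k0: "\<kappa> \<noteq> 0" using c by (auto simp: \<kappa>_def)
  have Nd: "coeff N d = \<kappa>" using p q by (simp add: N_def \<kappa>_def)
  moreover have "degree N \<le> d"
    unfolding N_def using p q by (intro degree_diff_le) (auto intro: order_trans[OF degree_smult_le])
  ultimately have dN: "degree N = d" "lead_coeff N = \<kappa>"
    using k0 le_degree by force+
  obtain r where r: "smult (lead_coeff N) (\<Prod>i<degree N. [:- r i, 1:]) = N"
    using complex_poly_decompose' by blast
  \<comment> \<open>The factorisation numbers the roots from \<open>0\<close>, Blaschke products from \<open>1\<close>.\<close>
  define \<alpha> where "\<alpha> j = r (j - 1)" for j
  have Nz: "poly N z = \<kappa> * (\<Prod>j=1..d. z - \<alpha> j)" for z
  proof -
    have "poly N z = \<kappa> * (\<Prod>i<d. z - r i)"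
      by (subst r[symmetric]) (simp add: dN Nd poly_prod)
    also have "(\<Prod>i<d. z - r i) = (\<Prod>j=1..d. z - \<alpha> j)"
      by (rule prod.reindex_bij_witness[of _ "\<lambda>j. j - 1" Suc]) (auto simp: \<alpha>_def)
    finally show ?thesis .
  qed
  have \<alpha>: "norm (\<alpha> j) < 1" if j: "j \<in> {1..d}" for j
  proof (rule ccontr)
    define z where "z = \<alpha> j"
    assume "\<not> norm (\<alpha> j) < 1"
    then have z: "norm z \<ge> 1" by (simp add: z_def)
    have "norm (1 - cnj (a i) * z) \<le> norm (z - a i)" if "i \<in> {1..d}" for i
    proof -
      have "(1 - (norm (a i))\<^sup>2) * (1 - (norm z)\<^sup>2) \<le> 0"
        using z a[OF that] by (intro mult_nonneg_nonpos) (auto simp: power_le_one less_imp_le)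
      then show ?thesis
        using norm_diff_conj_identity[of "a i" z] by - (rule power2_le_imp_le, linarith, simp)
    qed
    then have "norm (poly q z) \<le> norm (poly p z)"
      unfolding pz qz prod_norm[symmetric] by (intro prod_mono) auto
    moreover have "poly p z \<noteq> 0"
    proof
      assume "poly p z = 0"
      then obtain i where "i \<in> {1..d}" "z = a i"
        unfolding pz by (auto simp: prod_zero_iff)
      with a z show False by fastforce
    qed
    moreover have "poly N z = 0" using j by (auto simp: Nz z_def)
    then have "c * poly p z = b * poly q z" by (simp add: N_def)
    then have "norm (poly p z) = norm b * norm (poly q z)"
      by (metis c mult_1 norm_mult)
    moreover have "norm b * norm (poly q z) \<le> norm b * norm (poly p z)"
      using calculation(1) by (rule mult_left_mono) simp
    moreover have "norm b * norm (poly p z) < 1 * norm (poly p z)"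
      using b1 calculation(2) by (intro mult_strict_right_mono) simp_all
    ultimately show False by linarith
  qed
  \<comment> \<open>Reflection \<open>h \<mapsto> z ^ d * cnj (h (1 / cnj z))\<close> exchanges the two kinds of linear factors.\<close>
  have reflect: "z ^ d * cnj (\<Prod>j=1..d. inverse (cnj z) - s j) = (\<Prod>j=1..d. 1 - cnj (s j) * z)"
    "z ^ d * cnj (\<Prod>j=1..d. 1 - cnj (s j) * inverse (cnj z)) = (\<Prod>j=1..d. z - s j)"
    if "z \<noteq> 0" for z and s :: "nat \<Rightarrow> complex"
  proof -
    have *: "z ^ d * (\<Prod>j=1..d. h j) = (\<Prod>j=1..d. z * h j)" for h
      by (simp add: prod.distrib)
    show "z ^ d * cnj (\<Prod>j=1..d. inverse (cnj z) - s j) = (\<Prod>j=1..d. 1 - cnj (s j) * z)"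
      "z ^ d * cnj (\<Prod>j=1..d. 1 - cnj (s j) * inverse (cnj z)) = (\<Prod>j=1..d. z - s j)"
      unfolding cnj_prod * using that by (auto intro!: prod.cong simp: field_simps)
  qed
  have cc: "c * cnj c = 1" using c by (simp add: complex_norm_square[symmetric])
  have R: "poly q z - cnj b * c * poly p z = c * cnj \<kappa> * (\<Prod>j=1..d. 1 - cnj (\<alpha> j) * z)" for z
  proof (cases "z = 0")
    case True
    then show ?thesis using cc by (simp add: pz qz \<kappa>_def cnj_prod algebra_simps)
  next
    case False
    let ?y = "inverse (cnj z)"
    have "c * (z ^ d * cnj (poly N ?y)) = c * (z ^ d * cnj (c * poly p ?y - b * poly q ?y))"
      by (simp add: N_def)
    also have "\<dots> = c * cnj c * (z ^ d * cnj (poly p ?y)) - cnj b * c * (z ^ d * cnj (poly q ?y))"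
      by (simp add: algebra_simps)
    also have "\<dots> = poly q z - cnj b * c * poly p z"
      by (simp only: pz qz reflect[OF False] cc mult_1)
    finally have "poly q z - cnj b * c * poly p z = c * (z ^ d * cnj (poly N ?y))" by simp
    also have "\<dots> = c * cnj \<kappa> * (z ^ d * cnj (\<Prod>j=1..d. ?y - \<alpha> j))"
      by (simp add: Nz)
    finally show ?thesis by (simp only: reflect[OF False])
  qed
  have "disc_aut b (B z) = \<kappa> / (c * cnj \<kappa>) * (\<Prod>j=1..d. disc_aut (\<alpha> j) z)" if z: "z \<in> \<bbbD>" for z
  proof -
    have q0: "poly q z \<noteq> 0" unfolding qz using a z one_minus_cnj_mult_nonzero by auto
    have Bz: "B z = c * poly p z / poly q z"
      unfolding BD[rule_format, OF z] pz qz by (simp add: prod_dividef)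
    have "disc_aut b (B z) = poly N z / (poly q z - cnj b * c * poly p z)"
      unfolding Bz N_def using q0 by (simp add: divide_simps)
    also have "\<dots> = \<kappa> / (c * cnj \<kappa>) * (\<Prod>j=1..d. disc_aut (\<alpha> j) z)"
      unfolding R Nz by (simp add: prod_dividef)
    finally show ?thesis .
  qed
  moreover have "norm (\<kappa> / (c * cnj \<kappa>)) = 1" using k0 c by (simp add: norm_divide norm_mult)
  ultimately show ?thesis
    unfolding blaschke_product_altdef using \<alpha> mem_ball_0 by blast
qed

section \<open>The hyperbolic difference quotient\<close>

text \<open>For both the bound on the quotient and its identification with a Blaschke product, the base point \<open>w\<close> needs
  no computation: continuity carries the estimate there. The case \<open>e = 0\<close> extends identities.\<close>
lemma norm_bound_at_puncture:
  fixes h :: "complex \<Rightarrow> complex"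
  assumes h: "continuous_on \<bbbD> h" and le: "\<And>z. z \<in> \<bbbD> - {w} \<Longrightarrow> norm (h z) \<le> e" and z: "z \<in> \<bbbD>"
  shows "norm (h z) \<le> e"
proof (cases "z = w")
  case True
  have "(h \<longlongrightarrow> h w) (at w)"
    using h z True by (metis open_ball continuous_on_eq_continuous_at isCont_def)
  moreover have "eventually (\<lambda>u. u \<in> \<bbbD> - {w}) (at w)"
    using z True by (intro eventually_at_in_open) auto
  then have "eventually (\<lambda>u. norm (h u) \<le> e) (at w)"
    by eventually_elim (rule le)
  ultimately show ?thesis
    unfolding True by (intro Lim_norm_ubound[of "at w"]) auto
qed (use le z in auto)

lemma hyp_diff_quot_off_base:
  "z \<noteq> w \<Longrightarrow> hyp_diff_quot w f z = disc_aut (f w) (f z) / disc_aut w z"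
  by (simp add: hyp_diff_quot_def)

text \<open>The division-free form of the definition; in particular it also holds at the base point.\<close>
lemma hyp_diff_quot_mult:
  assumes "w \<in> \<bbbD>" "z \<in> \<bbbD>"
  shows "hyp_diff_quot w f z * disc_aut w z = disc_aut (f w) (f z)"
  using one_minus_cnj_mult_nonzero[of w z] assms
  by (cases "z = w") (auto simp: hyp_diff_quot_off_base)

text \<open>The quotient is \<open>1 - cnj w * z\<close> times the difference quotient at \<open>w\<close> of \<open>\<lambda>z. disc_aut (f w) (f z)\<close>, which has a
  removable singularity at \<open>w\<close>; the value prescribed at \<open>w\<close> is the one that removes it.\<close>
lemma holomorphic_hyp_diff_quot:
  assumes f: "f holomorphic_on \<bbbD>" "f ` \<bbbD> \<subseteq> \<bbbD>" and w: "w \<in> \<bbbD>"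
  shows "hyp_diff_quot w f holomorphic_on \<bbbD>"
proof -
  define N where "N z = disc_aut (f w) (f z)" for z
  define q where "q z = (if z = w then deriv N w else (N z - N w) / (z - w))" for z
  have fw: "norm (f w) < 1" using f(2) w by force
  have "N holomorphic_on \<bbbD>"
    unfolding N_def using holomorphic_disc_aut_comp[OF fw f] .
  then have q: "q holomorphic_on \<bbbD>"
    unfolding q_def by (rule pole_lemma_open) simp
  have fd: "(f has_field_derivative deriv f w) (at w)"
    using f(1) w by (intro holomorphic_derivI) auto
  have nz: "1 - cnj (f w) * f w \<noteq> 0"
    using one_minus_cnj_mult_nonzero fw by force
  have "(N has_field_derivative deriv f w / (1 - cnj (f w) * f w)) (at w)"
    unfolding N_def by (rule derivative_eq_intros fd refl nz)+ (use nz in simp)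
  then have dN: "deriv N w = deriv f w / (1 - cnj (f w) * f w)"
    by (rule DERIV_imp_deriv)
  have sq: "(complex_of_real (norm x))\<^sup>2 = x * cnj x" for x
    by (metis complex_norm_square of_real_power)
  have "q z * (1 - cnj w * z) = hyp_diff_quot w f z" if "z \<in> \<bbbD>" for z
  proof (cases "z = w")
    case True
    then show ?thesis
      by (simp add: q_def dN hyp_diff_quot_def sq mult.commute)
  next
    case False
    then show ?thesis
      by (simp add: q_def N_def hyp_diff_quot_off_base)
  qed
  moreover have "(\<lambda>z. q z * (1 - cnj w * z)) holomorphic_on \<bbbD>"
    by (intro holomorphic_intros q)
  ultimately show ?thesis
    by (rule holomorphic_transform[rotated])
qed

lemma norm_hyp_diff_quot_le_1:
  assumes f: "f holomorphic_on \<bbbD>" "f ` \<bbbD> \<subseteq> \<bbbD>" and w: "w \<in> \<bbbD>" and z: "z \<in> \<bbbD>"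
  shows "norm (hyp_diff_quot w f z) \<le> 1"
proof (rule norm_bound_at_puncture[OF _ _ z])
  show "continuous_on \<bbbD> (hyp_diff_quot w f)"
    by (intro holomorphic_on_imp_continuous_on holomorphic_hyp_diff_quot assms)
next
  fix u assume u: "u \<in> \<bbbD> - {w}"
  then have "norm (disc_aut (f w) (f u)) / norm (disc_aut w u) \<le> 1"
    using Schwarz_Pick[OF f w, of u] by (intro divide_le_eq_1[THEN iffD2]) (auto simp: order_less_le)
  then have "norm (disc_aut (f w) (f u) / disc_aut w u) \<le> 1"
    by (simp only: norm_divide)
  then show "norm (hyp_diff_quot w f u) \<le> 1"
    using u hyp_diff_quot_off_base[of u w f] by simp
qed

lemma blaschke_product_cong:
  "(\<And>z. z \<in> \<bbbD> \<Longrightarrow> f z = g z) \<Longrightarrow> blaschke_product d f \<longleftrightarrow> blaschke_product d g"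
  unfolding blaschke_product_def by simp

lemma blaschke_product_mult_disc_aut:
  assumes "blaschke_product d B" "w \<in> \<bbbD>"
  shows "blaschke_product (Suc d) (\<lambda>z. B z * disc_aut w z)"
proof -
  obtain c a where *: "norm c = 1" "\<forall>j\<in>{1..d}. a j \<in> \<bbbD>"
    "\<forall>z\<in>\<bbbD>. B z = c * (\<Prod>j=1..d. disc_aut (a j) z)"
    using assms unfolding blaschke_product_altdef by blast
  let ?a = "a(Suc d := w)"
  have "(\<Prod>j=1..Suc d. disc_aut (?a j) z) = (\<Prod>j=1..d. disc_aut (a j) z) * disc_aut w z" for z
  proof -
    have "(\<Prod>j=1..d. disc_aut (?a j) z) = (\<Prod>j=1..d. disc_aut (a j) z)"
      by (intro prod.cong) auto
    then show ?thesis
      by (subst prod.nat_ivl_Suc', simp) (simp only: mult.commute fun_upd_same)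
  qed
  then have "\<forall>z\<in>\<bbbD>. B z * disc_aut w z = c * (\<Prod>j=1..Suc d. disc_aut (?a j) z)"
    using * by (simp only: mult.assoc) simp
  moreover have "\<forall>j\<in>{1..Suc d}. ?a j \<in> \<bbbD>" using * assms by auto
  ultimately show ?thesis
    unfolding blaschke_product_altdef using *(1) by blast
qed

lemma holomorphic_blaschke_product:
  assumes "blaschke_product d B" shows "B holomorphic_on \<bbbD>"
proof -
  obtain c a where *: "\<forall>j\<in>{1..d}. a j \<in> \<bbbD>" "\<forall>z\<in>\<bbbD>. B z = c * (\<Prod>j=1..d. disc_aut (a j) z)"
    using assms unfolding blaschke_product_altdef by blast
  have "(\<lambda>z. c * (\<Prod>j=1..d. disc_aut (a j) z)) holomorphic_on \<bbbD>"
    using * by (intro holomorphic_intros holomorphic_on_prod holomorphic_disc_aut) auto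
  then show ?thesis
    by (rule holomorphic_transform) (use * in auto)
qed

lemma blaschke_product_factor_zero:
  assumes B: "blaschke_product (Suc d) B" and w: "w \<in> \<bbbD>" and Bw: "B w = 0"
  obtains C where "blaschke_product d C" "\<And>z. z \<in> \<bbbD> \<Longrightarrow> B z = C z * disc_aut w z"
proof -
  obtain c a where c: "norm c = 1" and a: "\<forall>j\<in>{1..Suc d}. a j \<in> \<bbbD>"
    and Beq: "\<forall>z\<in>\<bbbD>. B z = c * (\<Prod>j=1..Suc d. disc_aut (a j) z)"
    using B unfolding blaschke_product_altdef by blast
  have "(\<Prod>j=1..Suc d. disc_aut (a j) w) = 0"
    using Beq w Bw c by force
  then obtain i where i: "i \<in> {1..Suc d}" "disc_aut (a i) w = 0"
    using prod_zero_iff[of "{1..Suc d}" "\<lambda>j. disc_aut (a j) w"] by blast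
  then have ai: "a i = w"
    using one_minus_cnj_mult_nonzero[of "a i" w] a w by auto
  \<comment> \<open>Exchange the zero \<open>w\<close> with the last one.\<close>
  define b where "b = a \<circ> Transposition.transpose i (Suc d)"
  have perm: "Transposition.transpose i (Suc d) permutes {1..Suc d}"
    using i by (intro permutes_swap_id) auto
  have prod_eq: "(\<Prod>j=1..Suc d. disc_aut (a j) z) = (\<Prod>j=1..d. disc_aut (b j) z) * disc_aut w z" for z
  proof -
    have "(\<Prod>j=1..Suc d. disc_aut (a j) z) = (\<Prod>j=1..Suc d. disc_aut (b j) z)"
      using prod.permute[OF perm, of "\<lambda>j. disc_aut (a j) z"] by (simp add: o_def b_def)
    then show ?thesis by (simp add: b_def ai prod.nat_ivl_Suc' mult.commute)
  qed
  have "b j \<in> \<bbbD>" if "j \<in> {1..d}" for j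
    using a permutes_in_image[OF perm, of j] that by (auto simp: b_def)
  then have "blaschke_product d (\<lambda>z. c * (\<Prod>j=1..d. disc_aut (b j) z))"
    unfolding blaschke_product_altdef using c by blast
  moreover have "B z = c * (\<Prod>j=1..d. disc_aut (b j) z) * disc_aut w z" if "z \<in> \<bbbD>" for z
    using Beq[rule_format, OF that] by (simp only: prod_eq mult.assoc)
  ultimately show ?thesis using that by blast
qed

text \<open>The product of the quotient with \<open>disc_aut w\<close> is \<open>f\<close> followed by an automorphism that takes \<open>f w\<close> to \<open>0\<close>. The
  automorphism does not change the degree, and the factor \<open>disc_aut w\<close> accounts for the shift by one.\<close>
lemma blaschke_product_hyp_diff_quot_iff:
  assumes f: "f holomorphic_on \<bbbD>" "f ` \<bbbD> \<subseteq> \<bbbD>" and w: "w \<in> \<bbbD>"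
  shows "blaschke_product d (hyp_diff_quot w f) \<longleftrightarrow> blaschke_product (Suc d) f"
proof
  have fD: "norm (f x) < 1" if "norm x < 1" for x
    using f(2) that by force
  have fw: "f w \<in> \<bbbD>" using f(2) w by force
  {
    assume "blaschke_product d (hyp_diff_quot w f)"
    from blaschke_product_mult_disc_aut[OF this w]
    have "blaschke_product (Suc d) (\<lambda>z. disc_aut (f w) (f z))"
      by (rule blaschke_product_cong[THEN iffD1, rotated]) (rule hyp_diff_quot_mult[OF w])
    moreover have "- f w \<in> \<bbbD>" using fw by simp
    ultimately have "blaschke_product (Suc d) (\<lambda>z. disc_aut (- f w) (disc_aut (f w) (f z)))"
      by (rule blaschke_product_disc_aut_comp)
    then show "blaschke_product (Suc d) f"
    proof (rule blaschke_product_cong[THEN iffD1, rotated])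
      fix z assume "z \<in> \<bbbD>"
      then show "disc_aut (- f w) (disc_aut (f w) (f z)) = f z"
        using disc_aut_inverse[of "f w" "f z"] fD w by simp
    qed
  next
    assume "blaschke_product (Suc d) f"
    from blaschke_product_disc_aut_comp[OF this fw]
    obtain C where C: "blaschke_product d C"
      and eq: "\<And>z. z \<in> \<bbbD> \<Longrightarrow> disc_aut (f w) (f z) = C z * disc_aut w z"
      by (rule blaschke_product_factor_zero[OF _ w]) (simp, blast intro: that)
    have off: "norm (hyp_diff_quot w f z - C z) \<le> 0" if z: "z \<in> \<bbbD> - {w}" for z
    proof -
      have "disc_aut w z \<noteq> 0" using z w one_minus_cnj_mult_nonzero[of w z] by auto
      moreover have "hyp_diff_quot w f z * disc_aut w z = C z * disc_aut w z"
        using hyp_diff_quot_mult[OF w] eq z by simp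
      ultimately have "hyp_diff_quot w f z = C z"
        using mult_right_cancel by blast
      then show ?thesis by simp
    qed
    have "norm (hyp_diff_quot w f z - C z) \<le> 0" if z: "z \<in> \<bbbD>" for z
      by (rule norm_bound_at_puncture[OF _ off z])
        (intro continuous_intros holomorphic_on_imp_continuous_on holomorphic_hyp_diff_quot[OF f w]
          holomorphic_blaschke_product[OF C])
    then have "hyp_diff_quot w f z = C z" if "z \<in> \<bbbD>" for z
      using that by (simp add: norm_le_zero_iff)
    then show "blaschke_product d (hyp_diff_quot w f)"
      using blaschke_product_cong C by blast
  }
qed

lemma constant_of_norm_attains_1:
  fixes g :: "complex \<Rightarrow> complex"
  assumes g: "g holomorphic_on \<bbbD>" "\<And>z. z \<in> \<bbbD> \<Longrightarrow> norm (g z) \<le> 1"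
    and z0: "z0 \<in> \<bbbD>" "norm (g z0) = 1" and z: "z \<in> \<bbbD>"
  shows "g z = g z0"
proof -
  have "g constant_on \<bbbD>"
    using maximum_modulus_principle[OF g(1), of \<bbbD> z0] g(2) z0 by auto
  with z z0 show ?thesis by (auto simp: constant_on_def)
qed

text \<open>By the maximum principle, a value on the unit circle would make the quotient a unimodular constant, which is
  a Blaschke product of degree \<open>0\<close>.\<close>
lemma hyp_diff_quot_into_disc:
  assumes f: "f holomorphic_on \<bbbD>" "f ` \<bbbD> \<subseteq> \<bbbD>" and w: "w \<in> \<bbbD>"
    and nb: "\<not> blaschke_product 1 f"
  shows "hyp_diff_quot w f ` \<bbbD> \<subseteq> \<bbbD>"
proof (rule ccontr)
  note le = norm_hyp_diff_quot_le_1[OF f w]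
  assume "\<not> ?thesis"
  then obtain z0 where "z0 \<in> \<bbbD>" "\<not> norm (hyp_diff_quot w f z0) < 1" by (metis image_subsetI mem_ball_0)
  with le[of z0] have z0: "z0 \<in> \<bbbD>" "norm (hyp_diff_quot w f z0) = 1" by auto
  have "hyp_diff_quot w f z = hyp_diff_quot w f z0" if "z \<in> \<bbbD>" for z
    using constant_of_norm_attains_1[OF holomorphic_hyp_diff_quot[OF f w] le z0 that] .
  then have "blaschke_product 0 (hyp_diff_quot w f)"
    unfolding blaschke_product_altdef using z0(2) by auto
  with nb show False
    using blaschke_product_hyp_diff_quot_iff[OF f w, of 0] by (simp only: One_nat_def)
qed

text \<open>Equating the degrees \<open>d\<close> and \<open>d + k\<close> for all \<open>d\<close> at once makes the induction work: at \<open>d = 1\<close> it shows that the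
  next quotient maps into the open disc.\<close>
lemma iter_hyp_diff_quot_properties:
  assumes f: "f holomorphic_on \<bbbD>" "f ` \<bbbD> \<subseteq> \<bbbD>"
    and "\<forall>d\<le>k. \<not> blaschke_product d f" "\<forall>i\<in>{1..k}. w i \<in> \<bbbD>"
  shows "iter_hyp_diff_quot w k f holomorphic_on \<bbbD> \<and> iter_hyp_diff_quot w k f ` \<bbbD> \<subseteq> \<bbbD> \<and>
         (\<forall>d. blaschke_product d (iter_hyp_diff_quot w k f) \<longleftrightarrow> blaschke_product (d + k) f)"
  using assms(3,4)
proof (induction k)
  case 0
  then show ?case using f by simp
next
  case (Suc k)
  let ?g = "iter_hyp_diff_quot w k f"
  have g: "?g holomorphic_on \<bbbD>" "?g ` \<bbbD> \<subseteq> \<bbbD>"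
    and iff: "\<And>d. blaschke_product d ?g \<longleftrightarrow> blaschke_product (d + k) f"
    using Suc by auto
  have w: "w (Suc k) \<in> \<bbbD>" using Suc.prems by auto
  have "\<not> blaschke_product 1 ?g" using iff[of 1] Suc.prems by auto
  then show ?case
    using holomorphic_hyp_diff_quot[OF g w] hyp_diff_quot_into_disc[OF g w]
      blaschke_product_hyp_diff_quot_iff[OF g w] iff
    by (simp only: iter_hyp_diff_quot.simps add_Suc_right add_Suc) blast
qed

section \<open>The Julia inequality\<close>

lemma norm_one_minus_cnj_mult:
  assumes "norm l = 1" shows "norm (1 - cnj l * x) = norm (l - x)"
proof -
  have "cnj l * (l - x) = 1 - cnj l * x"
    using assms complex_norm_square[of l] by (simp add: algebra_simps)
  then show ?thesis
    by (metis assms complex_mod_cnj mult_1 norm_mult)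
qed

text \<open>The Schwarz-Pick lemma in a form that survives the passage of \<open>w\<close> to the boundary: on the right-hand
  side, only the quotient that the boundary dilation controls fails to be continuous there.\<close>
lemma Schwarz_Pick_kernel:
  assumes g: "g holomorphic_on \<bbbD>" "g ` \<bbbD> \<subseteq> \<bbbD>" and w: "w \<in> \<bbbD>" and z: "z \<in> \<bbbD>"
  shows "(norm (1 - cnj (g w) * g z))\<^sup>2 / (1 - (norm (g z))\<^sup>2)
     \<le> (1 - (norm (g w))\<^sup>2) / (1 - (norm w)\<^sup>2) * ((norm (1 - cnj w * z))\<^sup>2 / (1 - (norm z)\<^sup>2))"
proof -
  have n: "norm w < 1" "norm z < 1" "norm (g w) < 1" "norm (g z) < 1"
    using g(2) w z by force+
  have "(norm (disc_aut (g w) (g z)))\<^sup>2 \<le> (norm (disc_aut w z))\<^sup>2"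
    using Schwarz_Pick[OF g w z] by (intro power_mono) auto
  then have "(1 - (norm w)\<^sup>2) * (1 - (norm z)\<^sup>2) / (norm (1 - cnj w * z))\<^sup>2
     \<le> (1 - (norm (g w))\<^sup>2) * (1 - (norm (g z))\<^sup>2) / (norm (1 - cnj (g w) * g z))\<^sup>2"
    using one_minus_norm_disc_aut[of w z] one_minus_norm_disc_aut[of "g w" "g z"] n by linarith
  moreover have "A / Q \<le> P / R * (B / S)"
    if "R * S / B \<le> P * Q / A" "A > 0" "B > 0" "P > 0" "Q > 0" "R > 0" "S > 0" for A B P Q R S :: real
    using that by (simp add: field_simps)
  moreover have "norm (1 - cnj w * z) > 0" "norm (1 - cnj (g w) * g z) > 0"
    using n one_minus_cnj_mult_nonzero[of w z] one_minus_cnj_mult_nonzero[of "g w" "g z"] by simp_all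
  ultimately show ?thesis
    using n one_minus_norm_square_pos zero_less_power by blast
qed

lemma eventually_in_disc: "\<forall>\<^sub>F z in at \<sigma> within \<bbbD>. z \<in> \<bbbD>"
  by (simp add: eventually_at_filter)

lemma boundary_dilation_nonneg:
  assumes "g ` \<bbbD> \<subseteq> \<bbbD>" shows "0 \<le> boundary_dilation g \<sigma>"
  unfolding boundary_dilation_def
proof (rule Liminf_bounded)
  show "\<forall>\<^sub>F z in at \<sigma> within \<bbbD>. 0 \<le> ereal ((1 - norm (g z)) / (1 - norm z))"
    using eventually_in_disc
  proof eventually_elim
    case (elim z)
    then have "norm (g z) < 1" using assms by force
    with elim show ?case by simp
  qed
qed

lemma boundary_dilation_sequence:
  assumes b: "boundary_dilation g \<sigma> = ereal b"
  obtains Z where "\<And>n. Z n \<in> \<bbbD>" "Z \<longlonglongrightarrow> \<sigma>"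
    "\<And>n. (1 - norm (g (Z n))) / (1 - norm (Z n)) < b + inverse (real (Suc n))"
proof -
  have "\<exists>z. z \<in> \<bbbD> \<and> dist z \<sigma> < e \<and> (1 - norm (g z)) / (1 - norm z) < b + e" if e: "e > 0" for e
  proof (rule ccontr)
    assume none: "\<not> ?thesis"
    have "ereal (b + e) \<le> boundary_dilation g \<sigma>"
      unfolding boundary_dilation_def
    proof (rule Liminf_bounded)
      have "\<forall>\<^sub>F z in at \<sigma> within \<bbbD>. z \<in> \<bbbD> \<and> dist z \<sigma> < e"
        using e by (auto simp: eventually_at)
      then show "\<forall>\<^sub>F z in at \<sigma> within \<bbbD>. ereal (b + e) \<le> ereal ((1 - norm (g z)) / (1 - norm z))"
        by eventually_elim (use none in \<open>force simp: not_less\<close>)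
    qed
    with b e show False by simp
  qed
  then have "\<forall>n. \<exists>z. z \<in> \<bbbD> \<and> dist z \<sigma> < inverse (real (Suc n)) \<and>
      (1 - norm (g z)) / (1 - norm z) < b + inverse (real (Suc n))"
    by simp
  then obtain Z where Z: "\<And>n. Z n \<in> \<bbbD>" "\<And>n. dist (Z n) \<sigma> < inverse (real (Suc n))"
    "\<And>n. (1 - norm (g (Z n))) / (1 - norm (Z n)) < b + inverse (real (Suc n))"
    by metis
  have "(\<lambda>n. dist (Z n) \<sigma>) \<longlonglongrightarrow> 0"
    by (rule tendsto_sandwich[OF _ _ tendsto_const LIMSEQ_inverse_real_of_nat])
      (use Z(2) in \<open>auto intro!: always_eventually simp: less_imp_le\<close>)
  then have "Z \<longlonglongrightarrow> \<sigma>" by (rule tendsto_dist_iff[THEN iffD2])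
  then show ?thesis using that Z by blast
qed

text \<open>Along a sequence that attains the lower limit, \<open>norm (g (Z n))\<close> tends to \<open>1\<close>, so by compactness the values have a
  limit point \<open>l\<close> on the unit circle. The inequality is the limit of \<open>Schwarz_Pick_kernel\<close> with
  \<open>w = Z n\<close>. That \<open>l\<close> is the non-tangential limit is a consequence of the inequality.\<close>
lemma Julia_inequality:
  assumes g: "g holomorphic_on \<bbbD>" "g ` \<bbbD> \<subseteq> \<bbbD>" and \<sigma>: "norm \<sigma> = 1"
    and b: "boundary_dilation g \<sigma> = ereal b"
  obtains l where "norm l = 1"
    "\<And>z. z \<in> \<bbbD> \<Longrightarrow> (norm (l - g z))\<^sup>2 / (1 - (norm (g z))\<^sup>2) \<le> b * ((norm (\<sigma> - z))\<^sup>2 / (1 - (norm z)\<^sup>2))"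
proof -
  have gD: "norm (g z) < 1" if "norm z < 1" for z using g(2) that by force
  have b0: "b \<ge> 0" using boundary_dilation_nonneg[OF g(2), of \<sigma>] b by simp
  obtain Z0 where Z0: "\<And>n. Z0 n \<in> \<bbbD>" "Z0 \<longlonglongrightarrow> \<sigma>"
    "\<And>n. (1 - norm (g (Z0 n))) / (1 - norm (Z0 n)) < b + inverse (real (Suc n))"
    using boundary_dilation_sequence[OF b] by blast
  have "seq_compact (cball (0::complex) 1)"
    using compact_cball compact_imp_seq_compact by blast
  moreover have "\<forall>n. (g \<circ> Z0) n \<in> cball 0 1" using gD Z0(1) by (auto simp: less_imp_le)
  ultimately obtain l s where s: "strict_mono s" "((g \<circ> Z0) \<circ> s) \<longlonglongrightarrow> l"
    unfolding seq_compact_def by blast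
  define Z where "Z = Z0 \<circ> s"
  define e where "e n = inverse (real (Suc (s n)))" for n
  have Z: "norm (Z n) < 1" and FZ: "(1 - norm (g (Z n))) / (1 - norm (Z n)) < b + e n" for n
    using Z0 by (auto simp: Z_def e_def)
  have Zlim: "Z \<longlonglongrightarrow> \<sigma>"
    unfolding Z_def using Z0(2) s(1) by (rule LIMSEQ_subseq_LIMSEQ)
  have elim: "e \<longlonglongrightarrow> 0"
    unfolding e_def using LIMSEQ_subseq_LIMSEQ[OF LIMSEQ_inverse_real_of_nat s(1)] by (simp add: o_def)
  have glim: "(\<lambda>n. g (Z n)) \<longlonglongrightarrow> l" using s(2) by (simp add: o_def Z_def)
  have "(\<lambda>n. 1 - norm (g (Z n))) \<longlonglongrightarrow> 0"
  proof (rule tendsto_sandwich[OF _ _ tendsto_const])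
    have "(\<lambda>n. (b + e n) * (1 - norm (Z n))) \<longlonglongrightarrow> (b + 0) * (1 - norm \<sigma>)"
      by (intro tendsto_intros Zlim elim)
    then show "(\<lambda>n. (b + e n) * (1 - norm (Z n))) \<longlonglongrightarrow> 0" using \<sigma> by simp
    show "\<forall>\<^sub>F n in sequentially. 1 - norm (g (Z n)) \<le> (b + e n) * (1 - norm (Z n))"
      using FZ Z by (intro always_eventually allI) (simp add: pos_divide_less_eq less_imp_le)
  qed (use gD Z in \<open>auto intro!: always_eventually simp: less_imp_le\<close>)
  moreover have "(\<lambda>n. 1 - norm (g (Z n))) \<longlonglongrightarrow> 1 - norm l"
    by (intro tendsto_intros glim)
  ultimately have l: "norm l = 1" using LIMSEQ_unique by fastforce
  have "(norm (l - g z))\<^sup>2 / (1 - (norm (g z))\<^sup>2) \<le> b * ((norm (\<sigma> - z))\<^sup>2 / (1 - (norm z)\<^sup>2))"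
    if z: "z \<in> \<bbbD>" for z
  proof -
    let ?R = "\<lambda>n. (norm (1 - cnj (Z n) * z))\<^sup>2 / (1 - (norm z)\<^sup>2)"
    have z1: "1 - (norm z)\<^sup>2 > 0" "1 - (norm (g z))\<^sup>2 > 0"
      using z gD one_minus_norm_square_pos by auto
    have le: "(norm (1 - cnj (g (Z n)) * g z))\<^sup>2 / (1 - (norm (g z))\<^sup>2)
       \<le> (b + e n) * ((1 + norm (g (Z n))) / (1 + norm (Z n))) * ?R n" for n
    proof -
      have split: "(1 - (norm (g (Z n)))\<^sup>2) / (1 - (norm (Z n))\<^sup>2)
         = (1 - norm (g (Z n))) / (1 - norm (Z n)) * ((1 + norm (g (Z n))) / (1 + norm (Z n)))"
        by (simp add: power2_eq_square algebra_simps)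
      have "(1 - (norm (g (Z n)))\<^sup>2) / (1 - (norm (Z n))\<^sup>2)
         \<le> (b + e n) * ((1 + norm (g (Z n))) / (1 + norm (Z n)))"
        unfolding split using FZ[of n] by (intro mult_right_mono) (auto simp: less_imp_le)
      then have "(1 - (norm (g (Z n)))\<^sup>2) / (1 - (norm (Z n))\<^sup>2) * ?R n
         \<le> (b + e n) * ((1 + norm (g (Z n))) / (1 + norm (Z n))) * ?R n"
        using z1 by (intro mult_right_mono) auto
      then show ?thesis
        using Schwarz_Pick_kernel[OF g _ z, of "Z n"] Z by fastforce
    qed
    have nz: "1 + norm \<sigma> \<noteq> 0" by (simp add: \<sigma>)
    have "(norm (1 - cnj l * g z))\<^sup>2 / (1 - (norm (g z))\<^sup>2)
       \<le> (b + 0) * ((1 + norm l) / (1 + norm \<sigma>)) * ((norm (1 - cnj \<sigma> * z))\<^sup>2 / (1 - (norm z)\<^sup>2))"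
    proof (rule LIMSEQ_le)
      show "(\<lambda>n. (norm (1 - cnj (g (Z n)) * g z))\<^sup>2 / (1 - (norm (g z))\<^sup>2))
        \<longlonglongrightarrow> (norm (1 - cnj l * g z))\<^sup>2 / (1 - (norm (g z))\<^sup>2)"
        using z1 by (intro tendsto_intros glim) auto
      show "(\<lambda>n. (b + e n) * ((1 + norm (g (Z n))) / (1 + norm (Z n))) * ?R n)
        \<longlonglongrightarrow> (b + 0) * ((1 + norm l) / (1 + norm \<sigma>)) * ((norm (1 - cnj \<sigma> * z))\<^sup>2 / (1 - (norm z)\<^sup>2))"
        using z1 nz by (intro tendsto_intros glim elim Zlim) auto
    qed (use le in blast)
    then show ?thesis
      using l \<sigma> by (simp add: norm_one_minus_cnj_mult)
  qed
  with l show ?thesis using that by blast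
qed

lemma stolz_region_islimpt:
  assumes "norm \<sigma> = 1" "M > 1" shows "\<sigma> islimpt stolz_region \<sigma> M"
  unfolding islimpt_approachable
proof (intro allI impI)
  fix e :: real assume e: "e > 0"
  define t where "t = min (e / 2) (1 / 2)"
  have t: "0 < t" "t < e" "t < 1" using e by (auto simp: t_def min_def)
  let ?z = "(1 - t) *\<^sub>R \<sigma>"
  have d: "\<sigma> - ?z = t *\<^sub>R \<sigma>" by (simp add: scaleR_left_diff_distrib)
  have "norm ?z = 1 - t" "norm (\<sigma> - ?z) = t" using t assms(1) by (simp_all add: d)
  then show "\<exists>z\<in>stolz_region \<sigma> M. z \<noteq> \<sigma> \<and> dist z \<sigma> < e"
    using t assms(2)
    by (intro bexI[of _ ?z]) (auto simp: stolz_region_def dist_norm norm_minus_commute)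
qed

text \<open>Uniqueness of the limit in a single region suffices; the aperture \<open>2\<close> is arbitrary.\<close>
lemma nontangential_limit_eqI:
  assumes "norm \<sigma> = 1" "has_nontangential_limit g \<sigma> l"
  shows "nontangential_limit g \<sigma> = l"
  unfolding nontangential_limit_def
proof (rule the_equality)
  fix l' assume "has_nontangential_limit g \<sigma> l'"
  then have "(g \<longlongrightarrow> l') (at \<sigma> within stolz_region \<sigma> 2)" "(g \<longlongrightarrow> l) (at \<sigma> within stolz_region \<sigma> 2)"
    using assms(2) by (auto simp: has_nontangential_limit_def)
  moreover have "at \<sigma> within stolz_region \<sigma> 2 \<noteq> bot"
    using stolz_region_islimpt[OF assms(1), of 2] by (simp add: trivial_limit_within)
  ultimately show "l' = l" using tendsto_unique by blast
qed (rule assms(2))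

text \<open>In a region of aperture \<open>M\<close>, the factor \<open>(norm (\<sigma> - z))\<^sup>2 / (1 - (norm z)\<^sup>2)\<close> is at most
  \<open>M * norm (\<sigma> - z)\<close>, so the Julia inequality forces \<open>g z\<close> towards \<open>l\<close>.\<close>
lemma has_nontangential_limit_of_Julia:
  assumes g: "g ` \<bbbD> \<subseteq> \<bbbD>" and b: "b \<ge> 0"
    and J: "\<And>z. z \<in> \<bbbD> \<Longrightarrow> (norm (l - g z))\<^sup>2 / (1 - (norm (g z))\<^sup>2) \<le> b * ((norm (\<sigma> - z))\<^sup>2 / (1 - (norm z)\<^sup>2))"
  shows "has_nontangential_limit g \<sigma> l"
  unfolding has_nontangential_limit_def
proof (intro allI impI)
  fix M :: real assume M: "M > 1"
  let ?F = "at \<sigma> within stolz_region \<sigma> M"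
  have bound: "norm (l - g z) \<le> sqrt (b * M * norm (\<sigma> - z))" if z: "z \<in> stolz_region \<sigma> M" for z
  proof -
    have zD: "norm z < 1" and zM: "norm (\<sigma> - z) < M * (1 - norm z)"
      using z by (auto simp: stolz_region_def)
    then have gz: "norm (g z) < 1" using g by force
    note pos = one_minus_norm_square_pos[OF zD] one_minus_norm_square_pos[OF gz]
    have "1 - norm z \<le> 1 - (norm z)\<^sup>2"
      using zD by (simp add: power2_eq_square mult_left_le_one_le)
    then have "norm (\<sigma> - z) \<le> M * (1 - (norm z)\<^sup>2)"
      using zM M by (smt (verit) mult_left_mono)
    then have "norm (\<sigma> - z) * norm (\<sigma> - z) \<le> M * (1 - (norm z)\<^sup>2) * norm (\<sigma> - z)"
      by (rule mult_right_mono) simp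
    then have "(norm (\<sigma> - z))\<^sup>2 / (1 - (norm z)\<^sup>2) \<le> M * norm (\<sigma> - z)"
      using pos by (simp add: pos_divide_le_eq power2_eq_square algebra_simps)
    then have "b * ((norm (\<sigma> - z))\<^sup>2 / (1 - (norm z)\<^sup>2)) \<le> b * (M * norm (\<sigma> - z))"
      using b by (rule mult_left_mono)
    with J[of z] zD have "(norm (l - g z))\<^sup>2 / (1 - (norm (g z))\<^sup>2) \<le> b * M * norm (\<sigma> - z)" by simp
    moreover have "(norm (l - g z))\<^sup>2 \<le> (norm (l - g z))\<^sup>2 / (1 - (norm (g z))\<^sup>2)"
      using pos by (simp add: pos_le_divide_eq mult_left_le)
    ultimately show ?thesis by - (rule real_le_rsqrt, linarith)
  qed
  have "((\<lambda>z. sqrt (b * M * norm (\<sigma> - z))) \<longlongrightarrow> sqrt (b * M * norm (\<sigma> - \<sigma>))) ?F"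
    by (intro tendsto_intros)
  moreover have "\<forall>\<^sub>F z in ?F. norm (l - g z) \<le> sqrt (b * M * norm (\<sigma> - z))"
    using bound by (auto simp: eventually_at_filter)
  ultimately have "((\<lambda>z. l - g z) \<longlongrightarrow> 0) ?F"
    by (intro Lim_null_comparison[of "\<lambda>z. l - g z"]) auto
  then have "((\<lambda>z. l - (l - g z)) \<longlongrightarrow> l - 0) ?F"
    by (intro tendsto_intros)
  then show "(g \<longlongrightarrow> l) ?F" by simp
qed

section \<open>The case of equality\<close>

text \<open>The Cayley transform \<open>T\<close> turns the left half-plane into the disc, where the maximum modulus principle applies.\<close>
lemma constant_of_Re_attains_0:
  assumes K: "K holomorphic_on \<bbbD>" "\<And>z. z \<in> \<bbbD> \<Longrightarrow> Re (K z) \<le> 0"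
    and z0: "z0 \<in> \<bbbD>" "Re (K z0) = 0" and z: "z \<in> \<bbbD>"
  shows "K z = K z0"
proof -
  define T where "T u = (1 + K u) / (1 - K u)" for u
  have nz: "1 - K u \<noteq> 0" if "u \<in> \<bbbD>" for u
    using K(2)[OF that] by (auto simp: complex_eq_iff)
  have sq: "(norm (1 + K u))\<^sup>2 = (norm (1 - K u))\<^sup>2 + 4 * Re (K u)" for u
    unfolding cmod_power2 by (simp add: power2_eq_square algebra_simps)
  have "T holomorphic_on \<bbbD>" unfolding T_def using nz by (intro holomorphic_intros K) auto
  moreover have "norm (T u) \<le> 1" if u: "u \<in> \<bbbD>" for u
  proof -
    have "norm (1 + K u) \<le> norm (1 - K u)"
      using sq[of u] K(2)[OF u] by - (rule power2_le_imp_le, linarith, simp)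
    then show ?thesis using nz[OF u] by (simp add: T_def norm_divide)
  qed
  moreover have "norm (T z0) = 1"
  proof -
    have "norm (1 + K z0) = norm (1 - K z0)"
      using sq[of z0] z0 by - (rule power2_eq_imp_eq, auto)
    then show ?thesis using nz[OF z0(1)] by (simp add: T_def norm_divide)
  qed
  ultimately have "T z = T z0" using constant_of_norm_attains_1 z0 z by blast
  then show ?thesis
    using nz[OF z] nz[OF z0(1)] by (simp add: T_def field_simps)
qed

lemma Re_Cayley:
  assumes "norm l = 1" shows "Re ((l + x) / (l - x)) = (1 - (norm x)\<^sup>2) / (norm (l - x))\<^sup>2"
proof -
  have "Re ((l + x) / (l - x)) = Re ((l + x) * cnj (l - x)) / (norm (l - x))\<^sup>2"
    by (metis Re_complex_div_eq_0 Re_divide_of_real complex_div_cnj of_real_power)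
  also have "Re ((l + x) * cnj (l - x)) = (norm l)\<^sup>2 - (norm x)\<^sup>2"
    unfolding cmod_power2 by (simp add: algebra_simps power2_eq_square)
  finally show ?thesis using assms by simp
qed

lemma blaschke_product_1I:
  assumes "norm c = 1" "norm a < 1" "\<And>z. z \<in> \<bbbD> \<Longrightarrow> B z = c * disc_aut a z"
  shows "blaschke_product 1 B"
  unfolding blaschke_product_altdef using assms by (intro exI[of _ c] exI[of _ "\<lambda>_. a"]) auto

text \<open>By \<open>Re_Cayley\<close>, the Julia inequality says that \<open>K = (\<sigma> + z) / (\<sigma> - z) - b * (l + g z) / (l - g z)\<close> has nonpositive real
  part, with equality exactly where the real part vanishes. Equality at one point therefore makes \<open>K\<close> an
  imaginary constant, and solving for \<open>g\<close> gives a fractional linear map.\<close>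
lemma Julia_equality_imp_blaschke:
  assumes g: "g holomorphic_on \<bbbD>" "g ` \<bbbD> \<subseteq> \<bbbD>" and \<sigma>: "norm \<sigma> = 1" and l: "norm l = 1" and b: "b \<ge> 0"
    and J: "\<And>z. z \<in> \<bbbD> \<Longrightarrow> (norm (l - g z))\<^sup>2 / (1 - (norm (g z))\<^sup>2) \<le> b * ((norm (\<sigma> - z))\<^sup>2 / (1 - (norm z)\<^sup>2))"
    and z0: "z0 \<in> \<bbbD>"
    and eq: "(norm (l - g z0))\<^sup>2 / (1 - (norm (g z0))\<^sup>2) = b * ((norm (\<sigma> - z0))\<^sup>2 / (1 - (norm z0)\<^sup>2))"
  shows "blaschke_product 1 g"
proof -
  have gD: "norm (g z) < 1" if "z \<in> \<bbbD>" for z using g(2) that by force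
  have nz: "\<sigma> - z \<noteq> 0" "l - g z \<noteq> 0" if "z \<in> \<bbbD>" for z
    using gD[OF that] that l \<sigma> by auto
  have pos: "(norm (\<sigma> - z))\<^sup>2 > 0" "(norm (l - g z))\<^sup>2 > 0" "1 - (norm z)\<^sup>2 > 0" "1 - (norm (g z))\<^sup>2 > 0"
    if "z \<in> \<bbbD>" for z
    using nz[OF that] gD[OF that] that one_minus_norm_square_pos by auto
  have bpos: "b > 0"
    using eq pos[OF z0] b by (cases "b = 0") auto
  define K where "K z = (\<sigma> + z) / (\<sigma> - z) - of_real b * ((l + g z) / (l - g z))" for z
  have ReK: "Re (K z) = (1 - (norm z)\<^sup>2) / (norm (\<sigma> - z))\<^sup>2 - b * ((1 - (norm (g z))\<^sup>2) / (norm (l - g z))\<^sup>2)" for z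
    unfolding K_def minus_complex.sel Re_Cayley[OF \<sigma>]
    by (simp only: Re_Cayley[OF l] times_complex.sel Re_complex_of_real Im_complex_of_real mult_zero_left diff_0_right)
  have K: "K z = K z0" if z: "z \<in> \<bbbD>" for z
  proof (rule constant_of_Re_attains_0[OF _ _ z0 _ z])
    show "K holomorphic_on \<bbbD>"
      unfolding K_def using nz by (intro holomorphic_intros g(1)) auto
    show "Re (K u) \<le> 0" if u: "u \<in> \<bbbD>" for u
      using J[OF u] pos[OF u] unfolding ReK by (simp add: field_simps)
    show "Re (K z0) = 0"
      using eq pos[OF z0] unfolding ReK by (simp add: field_simps)
  qed
  have "Re (K z0) = 0" using eq pos[OF z0] unfolding ReK by (simp add: field_simps)
  then obtain c where c: "K z0 = \<i> * of_real c"
    by (metis complex_eq mult_zero_left of_real_0 add_0)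
  \<comment> \<open>Solving \<open>K z = \<i> * c\<close> for \<open>g z\<close> gives \<open>g z * (\<sigma> + z + cnj p * (\<sigma> - z)) = l * (\<sigma> + z - p * (\<sigma> - z))\<close>, and \<open>a\<close> is the
    zero of the right-hand side; it lies in the disc since \<open>p\<close> lies in the right half-plane.\<close>
  define p where "p = of_real b + \<i> * of_real c"
  define a where "a = (p - 1) / (p + 1) * \<sigma>"
  have Rep: "Re p > 0" using bpos by (simp add: p_def)
  have p1: "p + 1 \<noteq> 0" "cnj p + 1 \<noteq> 0" using Rep by (auto simp: complex_eq_iff)
  have "(norm (p - 1))\<^sup>2 < (norm (p + 1))\<^sup>2"
    unfolding cmod_power2 using Rep by (simp add: power2_eq_square algebra_simps)
  then have "norm (p - 1) < norm (p + 1)" by (rule power2_less_imp_less) simp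
  then have a: "norm a < 1" using p1 \<sigma> by (simp add: a_def norm_mult norm_divide)
  have \<sigma>\<sigma>: "\<sigma> * cnj \<sigma> = 1" using \<sigma> complex_norm_square[of \<sigma>] by simp
  have pa: "(p + 1) * a = (p - 1) * \<sigma>" "(cnj p + 1) * cnj a = (cnj p - 1) * cnj \<sigma>"
    using p1 by (simp_all add: a_def)
  have "(p + 1) * (z - a) = (p + 1) * z - (p + 1) * a" for z
    by (simp add: algebra_simps)
  then have num: "(p + 1) * (z - a) = (\<sigma> + z) - p * (\<sigma> - z)" for z
    unfolding pa by (simp add: algebra_simps)
  have den: "(cnj p + 1) * \<sigma> * (1 - cnj a * z) = (\<sigma> + z) + cnj p * (\<sigma> - z)" for z
  proof -
    have "(cnj p + 1) * \<sigma> * (1 - cnj a * z) = (cnj p + 1) * \<sigma> - ((cnj p + 1) * cnj a) * \<sigma> * z"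
      by (simp add: algebra_simps)
    also have "\<dots> = (cnj p + 1) * \<sigma> - (cnj p - 1) * (\<sigma> * cnj \<sigma>) * z"
      unfolding pa by (simp only: ac_simps)
    finally show ?thesis
      unfolding \<sigma>\<sigma> by (simp add: algebra_simps)
  qed
  have "g z = l * (p + 1) / ((cnj p + 1) * \<sigma>) * disc_aut a z" if z: "z \<in> \<bbbD>" for z
  proof -
    have "(\<sigma> + z) / (\<sigma> - z) - of_real b * ((l + g z) / (l - g z)) = \<i> * of_real c"
      using K[OF z] c by (simp add: K_def)
    then have "(\<sigma> + z) * (l - g z) - of_real b * (l + g z) * (\<sigma> - z) = \<i> * of_real c * (\<sigma> - z) * (l - g z)"
      using nz[OF z] by (simp add: divide_simps)
    then have "g z * ((\<sigma> + z) + cnj p * (\<sigma> - z)) = l * ((\<sigma> + z) - p * (\<sigma> - z))"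
      by (simp add: p_def algebra_simps)
    then have "g z * ((cnj p + 1) * \<sigma> * (1 - cnj a * z)) = l * ((p + 1) * (z - a))"
      by (simp only: num den)
    moreover have "(cnj p + 1) * \<sigma> * (1 - cnj a * z) \<noteq> 0"
      using p1 \<sigma> one_minus_cnj_mult_nonzero[OF a, of z] z by auto
    ultimately have "g z = l * ((p + 1) * (z - a)) / ((cnj p + 1) * \<sigma> * (1 - cnj a * z))"
      by (simp only: eq_divide_eq) simp
    then show ?thesis by simp
  qed
  moreover have "norm (l * (p + 1) / ((cnj p + 1) * \<sigma>)) = 1"
  proof -
    have "norm (cnj p + 1) = norm (p + 1)"
      by (metis complex_cnj_add complex_cnj_one complex_mod_cnj)
    then show ?thesis using p1 l \<sigma> by (simp add: norm_mult norm_divide)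
  qed
  ultimately show ?thesis using a by (intro blaschke_product_1I)
qed

text \<open>An automorphism extends continuously to \<open>\<sigma>\<close>, so its limit \<open>l\<close> and its dilation \<open>b\<close> are ordinary limits, and both
  sides can be computed.\<close>
lemma Julia_equality_of_blaschke:
  assumes g: "blaschke_product 1 g" and \<sigma>: "norm \<sigma> = 1" and z: "z \<in> \<bbbD>"
  shows "ereal ((norm (nontangential_limit g \<sigma> - g z))\<^sup>2 / (1 - (norm (g z))\<^sup>2))
       = boundary_dilation g \<sigma> * ereal ((norm (\<sigma> - z))\<^sup>2 / (1 - (norm z)\<^sup>2))"
proof -
  obtain c a where c: "norm c = 1" and a: "norm a < 1" and geq: "\<And>u. u \<in> \<bbbD> \<Longrightarrow> g u = c * disc_aut a u"
    using g unfolding blaschke_product_altdef by fastforce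
  have nz: "1 - cnj a * u \<noteq> 0" if "norm u \<le> 1" for u
    using one_minus_cnj_mult_nonzero[OF a that] .
  define l where "l = c * disc_aut a \<sigma>"
  define b where "b = (1 - (norm a)\<^sup>2) / (norm (1 - cnj a * \<sigma>))\<^sup>2"
  have lim: "(g \<longlongrightarrow> l) (at \<sigma> within S)" if S: "S \<subseteq> \<bbbD>" for S
  proof -
    have "((\<lambda>u. c * disc_aut a u) \<longlongrightarrow> l) (at \<sigma> within S)"
      unfolding l_def using nz[of \<sigma>] \<sigma> by (intro tendsto_intros) auto
    moreover have "\<forall>\<^sub>F u in at \<sigma> within S. c * disc_aut a u = g u"
      unfolding eventually_at_filter using S geq by (intro always_eventually) auto
    ultimately show ?thesis by (rule Lim_transform_eventually)
  qed
  have "has_nontangential_limit g \<sigma> l"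
    unfolding has_nontangential_limit_def
    by (intro allI impI lim) (auto simp: stolz_region_def)
  then have L: "nontangential_limit g \<sigma> = l" by (rule nontangential_limit_eqI[OF \<sigma>])
  have g1: "1 - (norm (g u))\<^sup>2 = (1 - (norm a)\<^sup>2) * (1 - (norm u)\<^sup>2) / (norm (1 - cnj a * u))\<^sup>2"
    if "u \<in> \<bbbD>" for u
  proof -
    have "norm (g u) = norm (disc_aut a u)"
      by (simp only: geq[OF that] norm_mult c mult_1)
    then show ?thesis using one_minus_norm_disc_aut[OF a, of u] that by simp
  qed
  have "(norm (disc_aut a \<sigma>))\<^sup>2 = 1"
    using one_minus_norm_disc_aut[OF a, of \<sigma>] \<sigma> by simp
  then have "norm (disc_aut a \<sigma>) = 1"
    using abs_square_eq_1[of "norm (disc_aut a \<sigma>)"] by (simp only: abs_norm_cancel)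
  then have l1: "norm l = 1"
    by (simp only: l_def norm_mult c mult_1)
  have "((\<lambda>u. (1 - (norm a)\<^sup>2) / (norm (1 - cnj a * u))\<^sup>2 * ((1 + norm u) / (1 + norm (g u))))
      \<longlongrightarrow> (1 - (norm a)\<^sup>2) / (norm (1 - cnj a * \<sigma>))\<^sup>2 * ((1 + norm \<sigma>) / (1 + norm l))) (at \<sigma> within \<bbbD>)"
    using nz[of \<sigma>] \<sigma> l1 by (intro tendsto_intros lim) auto
  moreover have "\<forall>\<^sub>F u in at \<sigma> within \<bbbD>. (1 - (norm a)\<^sup>2) / (norm (1 - cnj a * u))\<^sup>2 * ((1 + norm u) / (1 + norm (g u)))
       = (1 - norm (g u)) / (1 - norm u)"
    using eventually_in_disc
  proof eventually_elim
    case (elim u)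
    then have "1 - norm u > 0" by simp
    moreover have "1 + norm (g u) > 0" by (rule add_pos_nonneg) auto
    moreover have "(1 - norm (g u)) * (1 + norm (g u)) = (1 - (norm a)\<^sup>2) / (norm (1 - cnj a * u))\<^sup>2 * ((1 - norm u) * (1 + norm u))"
      using g1[OF elim] by (simp add: power2_eq_square algebra_simps)
    moreover have "A * (y / v) = X / x" if "x > 0" "v > 0" "X * v = A * (x * y)" for A X x y v :: real
      using that by (simp add: field_simps)
    ultimately show ?case by blast
  qed
  ultimately have "((\<lambda>u. (1 - norm (g u)) / (1 - norm u)) \<longlongrightarrow> b) (at \<sigma> within \<bbbD>)"
    using \<sigma> l1 by (simp add: b_def Lim_transform_eventually)
  then have "((\<lambda>u. ereal ((1 - norm (g u)) / (1 - norm u))) \<longlongrightarrow> ereal b) (at \<sigma> within \<bbbD>)"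
    by simp
  moreover have "at \<sigma> within \<bbbD> \<noteq> bot"
  proof -
    have "\<sigma> islimpt \<bbbD>"
      using stolz_region_islimpt[OF \<sigma>, of 2] by (rule islimpt_subset) (auto simp: stolz_region_def)
    then show ?thesis by (simp add: trivial_limit_within)
  qed
  ultimately have bd: "boundary_dilation g \<sigma> = ereal b"
    unfolding boundary_dilation_def by (intro lim_imp_Liminf)
  have "(norm (l - g z))\<^sup>2 / (1 - (norm (g z))\<^sup>2) = b * ((norm (\<sigma> - z))\<^sup>2 / (1 - (norm z)\<^sup>2))"
  proof -
    have nz': "1 - cnj a * \<sigma> \<noteq> 0" "1 - cnj a * z \<noteq> 0" using nz \<sigma> z by auto
    have "l - g z = c * ((1 - a * cnj a) * (\<sigma> - z) / ((1 - cnj a * \<sigma>) * (1 - cnj a * z)))"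
      using nz' by (simp add: l_def geq[OF z] divide_simps) (simp add: algebra_simps)
    moreover have "1 - a * cnj a = of_real (1 - (norm a)\<^sup>2)"
      by (simp add: complex_norm_square[symmetric])
    ultimately have "norm (l - g z) = (1 - (norm a)\<^sup>2) * norm (\<sigma> - z) / (norm (1 - cnj a * \<sigma>) * norm (1 - cnj a * z))"
      using c one_minus_norm_square_pos[OF a] by (simp add: norm_mult norm_divide del: of_real_diff)
    moreover have "(A * S / (X * Y))\<^sup>2 / (A * Q / Y\<^sup>2) = A / X\<^sup>2 * (S\<^sup>2 / Q)"
      if "A \<noteq> 0" "X \<noteq> 0" "Y \<noteq> 0" for A Q S X Y :: real
      using that by (simp add: power2_eq_square mult_ac)
    moreover have "1 - (norm a)\<^sup>2 \<noteq> 0" using one_minus_norm_square_pos[OF a] by simp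
    ultimately show ?thesis
      unfolding g1[OF z] b_def using nz' by simp
  qed
  then show ?thesis by (simp add: L bd)
qed

text \<open>An infinite dilation makes the right-hand side infinite, because \<open>norm (\<sigma> - z) > 0\<close>, and hence the
  inequality strict; this agrees with the second claim since an automorphism has finite dilation.\<close>
theorem Julia_lemma:
  assumes g: "g holomorphic_on \<bbbD>" "g ` \<bbbD> \<subseteq> \<bbbD>" and \<sigma>: "norm \<sigma> = 1" and z: "z \<in> \<bbbD>"
  defines "lhs \<equiv> ereal ((norm (nontangential_limit g \<sigma> - g z))\<^sup>2 / (1 - (norm (g z))\<^sup>2))"
    and "rhs \<equiv> boundary_dilation g \<sigma> * ereal ((norm (\<sigma> - z))\<^sup>2 / (1 - (norm z)\<^sup>2))"
  shows "lhs \<le> rhs" and "lhs = rhs \<longleftrightarrow> blaschke_product 1 g"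
proof -
  have "lhs \<le> rhs \<and> (lhs = rhs \<longrightarrow> blaschke_product 1 g)"
  proof (cases "boundary_dilation g \<sigma>")
    case (real b)
    have b: "b \<ge> 0" using boundary_dilation_nonneg[OF g(2), of \<sigma>] real by simp
    obtain l where l: "norm l = 1" and J: "\<And>z. z \<in> \<bbbD> \<Longrightarrow>
        (norm (l - g z))\<^sup>2 / (1 - (norm (g z))\<^sup>2) \<le> b * ((norm (\<sigma> - z))\<^sup>2 / (1 - (norm z)\<^sup>2))"
      using Julia_inequality[OF g \<sigma> real] by blast
    have "nontangential_limit g \<sigma> = l"
      by (intro nontangential_limit_eqI \<sigma> has_nontangential_limit_of_Julia[OF g(2) b J])
    then show ?thesis
      using J[OF z] Julia_equality_imp_blaschke[OF g \<sigma> l b J z]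
      by (simp add: lhs_def rhs_def real)
  next
    case PInf
    have "(norm (\<sigma> - z))\<^sup>2 / (1 - (norm z)\<^sup>2) > 0"
      using z \<sigma> one_minus_norm_square_pos[of z] by (intro divide_pos_pos) auto
    moreover have "\<infinity> * ereal x = \<infinity>" if "x > 0" for x :: real using that by simp
    ultimately have "rhs = \<infinity>" unfolding rhs_def PInf by blast
    then show ?thesis by (simp add: lhs_def)
  next
    case MInf
    then show ?thesis using boundary_dilation_nonneg[OF g(2), of \<sigma>] by simp
  qed
  then show "lhs \<le> rhs" "lhs = rhs \<longleftrightarrow> blaschke_product 1 g"
    using Julia_equality_of_blaschke[OF _ \<sigma> z] unfolding lhs_def rhs_def by blast+
qed

section \<open>Iterated quotients and the boundary inequality\<close>

theorem theorem1p5: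
  fixes f :: "complex \<Rightarrow> complex" and k :: nat and \<sigma> :: complex
  assumes "k \<ge> 1"
    and "f holomorphic_on \<bbbD>"
    and "f ` \<bbbD> \<subseteq> \<bbbD>"
    and "\<forall>d\<le>k. \<not> blaschke_product d f"
    and "\<sigma> \<in> sphere 0 1"
    and "boundary_dilation f \<sigma> < \<infinity>"
  shows "(\<forall>z\<in>\<bbbD>. \<forall>w. (\<forall>i\<in>{1..k}. w i \<in> \<bbbD>) \<longrightarrow>
            (let g = iter_hyp_diff_quot w k f in
             ereal ((norm (nontangential_limit g \<sigma> - g z))\<^sup>2 / (1 - (norm (g z))\<^sup>2))
               \<le> boundary_dilation g \<sigma> * ereal ((norm (\<sigma> - z))\<^sup>2 / (1 - (norm z)\<^sup>2))))
       \<and> ((\<exists>z\<in>\<bbbD>. \<exists>w. (\<forall>i\<in>{1..k}. w i \<in> \<bbbD>) \<and>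
            (let g = iter_hyp_diff_quot w k f in
             ereal ((norm (nontangential_limit g \<sigma> - g z))\<^sup>2 / (1 - (norm (g z))\<^sup>2))
               = boundary_dilation g \<sigma> * ereal ((norm (\<sigma> - z))\<^sup>2 / (1 - (norm z)\<^sup>2))))
          \<longleftrightarrow> (\<forall>z\<in>\<bbbD>. \<forall>w. (\<forall>i\<in>{1..k}. w i \<in> \<bbbD>) \<longrightarrow>
            (let g = iter_hyp_diff_quot w k f in
             ereal ((norm (nontangential_limit g \<sigma> - g z))\<^sup>2 / (1 - (norm (g z))\<^sup>2))
               = boundary_dilation g \<sigma> * ereal ((norm (\<sigma> - z))\<^sup>2 / (1 - (norm z)\<^sup>2)))))
       \<and> ((\<forall>z\<in>\<bbbD>. \<forall>w. (\<forall>i\<in>{1..k}. w i \<in> \<bbbD>) \<longrightarrow>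
            (let g = iter_hyp_diff_quot w k f in
             ereal ((norm (nontangential_limit g \<sigma> - g z))\<^sup>2 / (1 - (norm (g z))\<^sup>2))
               = boundary_dilation g \<sigma> * ereal ((norm (\<sigma> - z))\<^sup>2 / (1 - (norm z)\<^sup>2))))
          \<longleftrightarrow> blaschke_product (k + 1) f)"
proof -
  define eq where "eq z w \<longleftrightarrow> (let g = iter_hyp_diff_quot w k f in
      ereal ((norm (nontangential_limit g \<sigma> - g z))\<^sup>2 / (1 - (norm (g z))\<^sup>2))
        = boundary_dilation g \<sigma> * ereal ((norm (\<sigma> - z))\<^sup>2 / (1 - (norm z)\<^sup>2)))" for z w
  define le where "le z w \<longleftrightarrow> (let g = iter_hyp_diff_quot w k f in
      ereal ((norm (nontangential_limit g \<sigma> - g z))\<^sup>2 / (1 - (norm (g z))\<^sup>2))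
        \<le> boundary_dilation g \<sigma> * ereal ((norm (\<sigma> - z))\<^sup>2 / (1 - (norm z)\<^sup>2)))" for z w
  have \<sigma>: "norm \<sigma> = 1" using assms(5) by simp
  have main: "le z w \<and> (eq z w \<longleftrightarrow> blaschke_product (k + 1) f)"
    if z: "z \<in> \<bbbD>" and w: "\<forall>i\<in>{1..k}. w i \<in> \<bbbD>" for z w
  proof -
    let ?g = "iter_hyp_diff_quot w k f"
    have g: "?g holomorphic_on \<bbbD>" "?g ` \<bbbD> \<subseteq> \<bbbD>"
      and deg: "blaschke_product 1 ?g \<longleftrightarrow> blaschke_product (k + 1) f"
      using iter_hyp_diff_quot_properties[OF assms(2,3,4) w] by (simp_all add: add.commute)
    show ?thesis
      unfolding le_def eq_def Let_def using Julia_lemma[OF g \<sigma> z] deg by blast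
  qed
  \<comment> \<open>Equality does not depend on the points, so one admissible choice decides both quantified forms.\<close>
  obtain z0 :: complex and w0 :: "nat \<Rightarrow> complex" where "z0 \<in> \<bbbD>" "\<forall>i\<in>{1..k}. w0 i \<in> \<bbbD>"
    using that[of 0 "\<lambda>_. 0"] by simp
  with main show ?thesis
    unfolding eq_def[symmetric] le_def[symmetric] by blast
qed

end
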